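(* Let $m$ and $c$ be positive integers such that $m$ is divisible by $c$ and $m \geq c(c+1)$. Suppose a binary image $F$ consists of $m^2$ ones and has a boundary of length $4mc$. Then the largest connected component of $F$ consists of at least $\frac{m^2}{c^2}$ ones.
   Context: A cell is a unit square in $\mathbb{R}^2$ whose vertices have integer coordinates. A binary image is a (finite) rectangle in $\mathbb{R}^2$ made up of cells, in which each cell has been assigned a value $0$ or $1$. A cell with value $1$ is called a one, a cell with value $0$ a zero; the image consists of $N$ ones if exactly $N$ of its cells have value $1$. Two cells are neighbours if they have a common edge. Two ones $c, c'$ are connected if there is a path $c=c_1,\dots,c_n=c'$ of ones with $c_i$ and $c_{i+1}$ neighbours for $1\le i\le n-1$; the equivalence classes of this relation are the connected components of the image. An edge of a cell belongs to the boundary of the image if it is the common edge of two neighbouring cells of the rectangle, one with value $1$ and one with value $0$, or if it belongs to exactly one cell of the rectangle (i.e. lies on the outer edge of the rectangle) and that cell has value $1$. The length of the boundary is the number of edges belonging to the boundary. *)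

theory Defs
  imports Complex_Main
begin

text \<open>
  The unit square with corners \<open>(x, y)\<close>, \<open>(x + 1, y)\<close>, \<open>(x, y + 1)\<close>, \<open>(x + 1, y + 1)\<close> is
  represented by its lower left corner \<open>(x, y)\<close>, and an edge by the set of its two end points.
\<close>

type_synonym cell = "int \<times> int"
type_synonym edge = "(int \<times> int) set"

fun cell_edges :: "cell \<Rightarrow> edge set" where
  "cell_edges (x, y) =
    {{(x, y), (x + 1, y)}, {(x, y + 1), (x + 1, y + 1)},
     {(x, y), (x, y + 1)}, {(x + 1, y), (x + 1, y + 1)}}"

definition neighbours :: "cell \<Rightarrow> cell \<Rightarrow> bool" where
  "neighbours p q \<longleftrightarrow> p \<noteq> q \<and> cell_edges p \<inter> cell_edges q \<noteq> {}"

definition binary_image :: "cell set \<Rightarrow> (cell \<Rightarrow> nat) \<Rightarrow> bool" where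
  "binary_image R F \<longleftrightarrow>
    (\<exists>x1 x2 y1 y2. x1 < x2 \<and> y1 < y2 \<and> R = {x1..<x2} \<times> {y1..<y2}) \<and> (\<forall>p\<in>R. F p \<in> {0, 1})"

definition ones :: "cell set \<Rightarrow> (cell \<Rightarrow> nat) \<Rightarrow> cell set" where
  "ones R F = {p \<in> R. F p = 1}"

definition connected_ones :: "cell set \<Rightarrow> (cell \<Rightarrow> nat) \<Rightarrow> cell rel" where
  "connected_ones R F = {(p, q). \<exists>ps. ps \<noteq> [] \<and> hd ps = p \<and> last ps = q \<and>
     set ps \<subseteq> ones R F \<and> successively neighbours ps}"

definition components :: "cell set \<Rightarrow> (cell \<Rightarrow> nat) \<Rightarrow> cell set set" where
  "components R F = ones R F // connected_ones R F"

text \<open>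
  The first set consists of the common edges of a one and a zero of the rectangle, the second
  one of the edges on the outer edge of the rectangle that belong to a one.
\<close>

definition boundary :: "cell set \<Rightarrow> (cell \<Rightarrow> nat) \<Rightarrow> edge set" where
  "boundary R F =
    {e. \<exists>p\<in>R. \<exists>q\<in>R. neighbours p q \<and> e \<in> cell_edges p \<inter> cell_edges q \<and> F p = 1 \<and> F q = 0} \<union>
    {e. \<exists>p. {q \<in> R. e \<in> cell_edges q} = {p} \<and> F p = 1}"

lemma neighbours_sym: "neighbours p q \<Longrightarrow> neighbours q p"
  by (auto simp: neighbours_def)

lemma equiv_connected_ones: "equiv (ones R F) (connected_ones R F)"
proof (rule equivI)
  show "connected_ones R F \<subseteq> ones R F \<times> ones R F"
    by (auto simp: connected_ones_def dest: hd_in_set last_in_set)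
  show "refl_on (ones R F) (connected_ones R F)"
  proof (rule refl_onI)
    fix p assume "p \<in> ones R F"
    then show "(p, p) \<in> connected_ones R F"
      unfolding connected_ones_def by (auto intro!: exI[of _ "[p]"])
  qed
  show "sym (connected_ones R F)"
  proof (rule symI)
    fix p q assume "(p, q) \<in> connected_ones R F"
    then obtain ps where ps: "ps \<noteq> []" "hd ps = p" "last ps = q" "set ps \<subseteq> ones R F"
      "successively neighbours ps"
      unfolding connected_ones_def by auto
    have "successively neighbours (rev ps)"
      using ps(5) by (auto intro: successively_mono neighbours_sym)
    with ps show "(q, p) \<in> connected_ones R F"
      unfolding connected_ones_def by (auto intro!: exI[of _ "rev ps"] simp: hd_rev last_rev)
  qed
  show "trans (connected_ones R F)"
  proof (rule transI)
    fix p q r assume "(p, q) \<in> connected_ones R F" "(q, r) \<in> connected_ones R F"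
    then obtain ps qs where ps: "ps \<noteq> []" "hd ps = p" "last ps = q" "set ps \<subseteq> ones R F"
        "successively neighbours ps"
      and qs: "qs \<noteq> []" "hd qs = q" "last qs = r" "set qs \<subseteq> ones R F"
        "successively neighbours qs"
      unfolding connected_ones_def by auto
    obtain t where t: "qs = q # t" using qs(1,2) by (cases qs) auto
    have "successively neighbours (ps @ t)"
      using ps(1,3,5) qs(5) t by (auto simp: successively_append_iff successively_Cons)
    moreover have "last (ps @ t) = r"
      using ps(3) qs(3) t by (cases "t = []") auto
    ultimately show "(p, r) \<in> connected_ones R F"
      using ps qs(4) t unfolding connected_ones_def
      by (auto intro!: exI[of _ "ps @ t"])
  qed
qed

lemma finite_components:
  assumes "binary_image R F"
  shows "finite (components R F)"
proof -
  have "finite (ones R F)"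
    using assms by (auto simp: binary_image_def ones_def)
  then show ?thesis
    unfolding components_def
    by (rule finite_quotient) (use equiv_connected_ones in \<open>auto simp: equiv_def\<close>)
qed

end

theory Submission
  imports Defs
begin

text \<open>
  A finite set of \<open>n\<close> cells that meets \<open>a\<close> columns and \<open>b\<close> rows has at least \<open>2 (a + b)\<close> boundary
  edges, two in every column and two in every row, so by \<open>n \<le> a b\<close> and AM-GM the number \<open>p\<close> of its
  boundary edges satisfies \<open>16 n \<le> p\<^sup>2\<close>. If every component had \<open>n < m\<^sup>2 / c\<^sup>2\<close> ones, then
  \<open>4 c n < m p\<close> for each of them. The boundary edges of the components are disjoint parts of the
  boundary of the image, so summation gives \<open>4 c m\<^sup>2 < m (4 m c)\<close>, a contradiction.
\<close>

section \<open>Edges of the grid and the cells they belong to\<close>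

definition hedge :: "int \<Rightarrow> int \<Rightarrow> edge" where
  "hedge x y = {(x, y), (x + 1, y)}"

definition vedge :: "int \<Rightarrow> int \<Rightarrow> edge" where
  "vedge x y = {(x, y), (x, y + 1)}"

lemma hedge_eq_iff: "hedge x y = hedge x' y' \<longleftrightarrow> x = x' \<and> y = y'"
  by (auto simp: hedge_def doubleton_eq_iff)

lemma vedge_eq_iff: "vedge x y = vedge x' y' \<longleftrightarrow> x = x' \<and> y = y'"
  by (auto simp: vedge_def doubleton_eq_iff)

lemma hedge_neq_vedge: "hedge x y \<noteq> vedge x' y'"
  by (auto simp: hedge_def vedge_def doubleton_eq_iff)

lemma cell_edges_eq:
  "cell_edges (x, y) = {hedge x y, hedge x (y + 1), vedge x y, vedge (x + 1) y}"
  by (auto simp: hedge_def vedge_def)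

lemma hedge_in_cell_edges_iff: "hedge x y \<in> cell_edges (a, b) \<longleftrightarrow> a = x \<and> (b = y \<or> b = y - 1)"
  by (auto simp: cell_edges_eq hedge_eq_iff hedge_neq_vedge simp del: cell_edges.simps)

lemma vedge_in_cell_edges_iff: "vedge x y \<in> cell_edges (a, b) \<longleftrightarrow> b = y \<and> (a = x \<or> a = x - 1)"
  by (auto simp: cell_edges_eq vedge_eq_iff hedge_neq_vedge[symmetric] simp del: cell_edges.simps)

text \<open>A horizontal edge belongs only to the cells above and below it, a vertical one only to
  those right and left of it.\<close>

lemma edge_in_at_most_two_cells:
  assumes "e \<in> cell_edges p" "e \<in> cell_edges q" "e \<in> cell_edges r" "p \<noteq> q"
  shows "r = p \<or> r = q"
proof -
  obtain x y where "e = hedge x y \<or> e = vedge x y"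
    using assms(1) by (cases p) (auto simp: cell_edges_eq simp del: cell_edges.simps)
  then show ?thesis
    using assms
    by (cases p; cases q; cases r)
      (auto simp: hedge_in_cell_edges_iff vedge_in_cell_edges_iff simp del: cell_edges.simps)
qed

section \<open>The isoperimetric inequality for finite sets of cells\<close>

text \<open>The outside cell \<open>q\<close> ranges over the whole plane, so the outer edge of the
  rectangle is no special case.\<close>

definition edge_boundary :: "cell set \<Rightarrow> edge set" where
  "edge_boundary C = {e. \<exists>p\<in>C. \<exists>q. q \<notin> C \<and> e \<in> cell_edges p \<inter> cell_edges q}"

text \<open>The inequality of truth values covers both the bottom edge of a cell of \<open>C\<close>
  and the top edge of one.\<close>

lemma hedge_in_edge_boundary:
  "((x, y) \<in> C) \<noteq> ((x, y - 1) \<in> C) \<Longrightarrow> hedge x y \<in> edge_boundary C"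
  unfolding edge_boundary_def
  by (auto simp: hedge_in_cell_edges_iff Bex_def simp del: cell_edges.simps)

lemma vedge_in_edge_boundary:
  "((x, y) \<in> C) \<noteq> ((x - 1, y) \<in> C) \<Longrightarrow> vedge x y \<in> edge_boundary C"
  unfolding edge_boundary_def
  by (auto simp: vedge_in_cell_edges_iff Bex_def simp del: cell_edges.simps)

lemma finite_edge_boundary:
  assumes "finite C"
  shows "finite (edge_boundary C)"
proof (rule finite_subset)
  show "edge_boundary C \<subseteq> (\<Union>p\<in>C. cell_edges p)"
    by (auto simp: edge_boundary_def)
  have "finite (cell_edges p)" for p
    by (cases p) simp
  then show "finite (\<Union>p\<in>C. cell_edges p)"
    using assms by blast
qed

text \<open>Applied to a single column or row: membership changes at \<open>Min S\<close> and at
  \<open>Max S + 1\<close>, and the last claim keeps the two edges found there apart.\<close>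

lemma finite_int_set_ends:
  fixes S :: "int set"
  assumes "finite S" "S \<noteq> {}"
  shows "Min S \<in> S" "Min S - 1 \<notin> S" "Max S \<in> S" "Max S + 1 \<notin> S" "Min S < Max S + 1"
proof -
  show "Min S \<in> S" "Max S \<in> S"
    using assms by simp_all
  then have "Min S \<le> Max S"
    using assms by simp
  then show "Min S < Max S + 1"
    by simp
  show "Min S - 1 \<notin> S"
    using Min_le[OF assms(1), of "Min S - 1"] by auto
  show "Max S + 1 \<notin> S"
    using Max_ge[OF assms(1), of "Max S + 1"] by auto
qed

lemma card_edge_boundary_ge:
  assumes fin: "finite C"
  shows "2 * (card (fst ` C) + card (snd ` C)) \<le> card (edge_boundary C)"
proof -
  define col where "col x = {y. (x, y) \<in> C}" for x
  define row where "row y = {x. (x, y) \<in> C}" for y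
  have col: "finite (col x)" "col x \<noteq> {}" if "x \<in> fst ` C" for x
  proof -
    have "col x \<subseteq> snd ` C" by (force simp: col_def)
    then show "finite (col x)" using fin finite_subset by blast
    show "col x \<noteq> {}" using that by (auto simp: col_def)
  qed
  have row: "finite (row y)" "row y \<noteq> {}" if "y \<in> snd ` C" for y
  proof -
    have "row y \<subseteq> fst ` C" by (force simp: row_def)
    then show "finite (row y)" using fin finite_subset by blast
    show "row y \<noteq> {}" using that by (auto simp: row_def)
  qed
  note col_ends = finite_int_set_ends[OF col] and row_ends = finite_int_set_ends[OF row]
  \<comment> \<open>Bottom edge of the lowest and top edge of the highest cell in each column; then
    left edge of the leftmost and right edge of the rightmost cell in each row. The
    \<open>+ 1\<close> passes to the far side of a cell.\<close>
  define B where "B = (\<lambda>x. hedge x (Min (col x))) ` fst ` C"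
  define T where "T = (\<lambda>x. hedge x (Max (col x) + 1)) ` fst ` C"
  define L where "L = (\<lambda>y. vedge (Min (row y)) y) ` snd ` C"
  define G where "G = (\<lambda>y. vedge (Max (row y) + 1) y) ` snd ` C"
  have "B \<subseteq> edge_boundary C" "T \<subseteq> edge_boundary C"
    using col_ends(1-4) unfolding B_def T_def col_def
    by (auto intro!: hedge_in_edge_boundary simp del: fst_conv)
  moreover have "L \<subseteq> edge_boundary C" "G \<subseteq> edge_boundary C"
    using row_ends(1-4) unfolding L_def G_def row_def
    by (auto intro!: vedge_in_edge_boundary simp del: snd_conv)
  ultimately have sub: "(B \<union> T) \<union> (L \<union> G) \<subseteq> edge_boundary C"
    by blast
  have card: "card B = card (fst ` C)" "card T = card (fst ` C)"
    "card L = card (snd ` C)" "card G = card (snd ` C)"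
    unfolding B_def T_def L_def G_def
    by (rule card_image; simp add: inj_on_def hedge_eq_iff vedge_eq_iff)+
  have finBT: "finite B" "finite T" "finite L" "finite G"
    unfolding B_def T_def L_def G_def using fin by simp_all
  have "B \<inter> T = {}"
    using col_ends(5) unfolding B_def T_def by (fastforce simp: hedge_eq_iff)
  moreover have "L \<inter> G = {}"
    using row_ends(5) unfolding L_def G_def by (fastforce simp: vedge_eq_iff)
  moreover have "(B \<union> T) \<inter> (L \<union> G) = {}"
    unfolding B_def T_def L_def G_def
    by (auto simp: hedge_neq_vedge hedge_neq_vedge[symmetric])
  ultimately have "card ((B \<union> T) \<union> (L \<union> G)) = 2 * (card (fst ` C) + card (snd ` C))"
    using finBT card by (simp add: card_Un_disjoint)
  then show ?thesis
    using card_mono[OF finite_edge_boundary[OF fin] sub] by simp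
qed

lemma isoperimetric:
  assumes "finite C"
  shows "16 * card C \<le> (card (edge_boundary C))\<^sup>2"
proof -
  let ?a = "card (fst ` C)" and ?b = "card (snd ` C)"
  have "card C \<le> card (fst ` C \<times> snd ` C)"
    by (rule card_mono) (use assms in \<open>auto intro: rev_image_eqI\<close>)
  then have "16 * card C \<le> 16 * (?a * ?b)"
    by (simp add: card_cartesian_product)
  also have "\<dots> \<le> (2 * (?a + ?b))\<^sup>2"
  proof -
    \<comment> \<open>The difference of the two sides is \<open>4 * (a - b)\<^sup>2\<close>; it is
      taken in the integers, as subtraction of naturals truncates.\<close>
    have "int (16 * (?a * ?b)) \<le> int ((2 * (?a + ?b))\<^sup>2)"
      using zero_le_power2[of "int ?a - int ?b"] by (simp add: power2_eq_square algebra_simps)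
    then show ?thesis
      by linarith
  qed
  also have "\<dots> \<le> (card (edge_boundary C))\<^sup>2"
    using card_edge_boundary_ge[OF assms] by (rule power_mono) simp
  finally show ?thesis .
qed

section \<open>Components and the boundary of the image\<close>

text \<open>Two neighbouring ones form a path by themselves. Hence a cell outside \<open>C\<close>
  that shares an edge with a cell of \<open>C\<close> is never a one.\<close>

lemma component_closed:
  assumes "C \<in> components R F" "p \<in> C" "q \<in> ones R F" "neighbours p q"
  shows "q \<in> C"
proof -
  have "p \<in> ones R F"
    using assms(1,2) in_quotient_imp_subset[OF equiv_connected_ones]
    unfolding components_def by blast
  then have "(p, q) \<in> connected_ones R F"
    using assms(3,4) unfolding connected_ones_def by (auto intro!: exI[of _ "[p, q]"])
  then show ?thesis
    using in_quotient_imp_closed[OF equiv_connected_ones] assms(1,2)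
    unfolding components_def by blast
qed

lemma component_subset_ones: "C \<in> components R F \<Longrightarrow> C \<subseteq> ones R F"
  unfolding components_def by (rule in_quotient_imp_subset[OF equiv_connected_ones])

lemma edge_boundary_component_subset:
  assumes img: "binary_image R F" and C: "C \<in> components R F"
  shows "edge_boundary C \<subseteq> boundary R F"
proof
  fix e assume "e \<in> edge_boundary C"
  then obtain p q where pq: "p \<in> C" "q \<notin> C" and e: "e \<in> cell_edges p" "e \<in> cell_edges q"
    unfolding edge_boundary_def by blast
  have p: "p \<in> R" "F p = 1"
    using component_subset_ones[OF C] pq(1) by (auto simp: ones_def)
  have "p \<noteq> q"
    using pq by blast
  then have nb: "neighbours p q"
    using e by (auto simp: neighbours_def)
  show "e \<in> boundary R F"
  proof (cases "q \<in> R")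
    case True
    then have "F q \<noteq> 1"
      using component_closed[OF C pq(1) _ nb] pq(2) by (auto simp: ones_def)
    then have "F q = 0"
      using img True unfolding binary_image_def by auto
    then show ?thesis
      unfolding boundary_def using True p nb e by blast
  next
    case False
    \<comment> \<open>Only \<open>p\<close> and \<open>q\<close> have the edge \<open>e\<close>, and
      \<open>q\<close> is outside \<open>R\<close>, so \<open>e\<close> lies on the outer edge of
      the rectangle.\<close>
    then have "{r \<in> R. e \<in> cell_edges r} = {p}"
      using edge_in_at_most_two_cells[OF e _ \<open>p \<noteq> q\<close>] e p by blast
    then show ?thesis
      unfolding boundary_def using p by blast
  qed
qed

text \<open>A common edge would belong to a one of \<open>C\<close> and a one of \<open>D\<close>;
  these would be neighbours and so in the same component.\<close>

lemma edge_boundary_components_disjoint: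
  assumes C: "C \<in> components R F" and D: "D \<in> components R F" and "C \<noteq> D"
  shows "edge_boundary C \<inter> edge_boundary D = {}"
proof (rule ccontr)
  assume "edge_boundary C \<inter> edge_boundary D \<noteq> {}"
  then obtain e p r where pr: "p \<in> C" "r \<in> D" and e: "e \<in> cell_edges p" "e \<in> cell_edges r"
    unfolding edge_boundary_def by blast
  have disj: "C \<inter> D = {}"
    using quotient_disj[OF equiv_connected_ones] assms unfolding components_def by blast
  then have "neighbours p r"
    using pr e by (auto simp: neighbours_def)
  then have "r \<in> C"
    using component_closed[OF C pr(1)] component_subset_ones[OF D] pr(2) by blast
  then show False
    using disj pr(2) by blast
qed

lemma finite_boundary:
  assumes "binary_image R F"
  shows "finite (boundary R F)"
proof (rule finite_subset)
  show "boundary R F \<subseteq> (\<Union>p\<in>R. cell_edges p)"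
    unfolding boundary_def by blast
  have "finite (cell_edges p)" for p
    by (cases p) simp
  moreover have "finite R"
    using assms by (auto simp: binary_image_def)
  ultimately show "finite (\<Union>p\<in>R. cell_edges p)"
    by blast
qed

lemma sum_card_edge_boundary_le:
  assumes "binary_image R F"
  shows "(\<Sum>C\<in>components R F. card (edge_boundary C)) \<le> card (boundary R F)"
proof -
  have sub: "(\<Union>C\<in>components R F. edge_boundary C) \<subseteq> boundary R F"
    using edge_boundary_component_subset[OF assms] by blast
  have "(\<Sum>C\<in>components R F. card (edge_boundary C)) = card (\<Union>C\<in>components R F. edge_boundary C)"
    using finite_components[OF assms] finite_boundary[OF assms] sub
      edge_boundary_components_disjoint
    by (intro card_UN_disjoint[symmetric]) (auto intro: finite_subset)
  also have "\<dots> \<le> card (boundary R F)"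
    using finite_boundary[OF assms] sub by (rule card_mono)
  finally show ?thesis .
qed

lemma sum_card_components:
  assumes "finite (ones R F)"
  shows "(\<Sum>C\<in>components R F. card C) = card (ones R F)"
proof -
  have U: "\<Union>(components R F) = ones R F"
    unfolding components_def by (rule Union_quotient[OF equiv_connected_ones])
  have "pairwise disjnt (components R F)"
    using quotient_disj[OF equiv_connected_ones]
    unfolding components_def pairwise_def disjnt_def by blast
  then have "card (\<Union>(components R F)) = sum card (components R F)"
    by (rule card_Union_disjoint)
      (use assms in \<open>auto intro: finite_subset[OF component_subset_ones]\<close>)
  then show ?thesis
    using U by simp
qed

section \<open>Comparing area and boundary length over all components\<close>

lemma small_set_edge_boundary:
  fixes m c :: nat
  assumes "finite C" "C \<noteq> {}" "card C * c\<^sup>2 < m\<^sup>2"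
  shows "4 * c * card C < m * card (edge_boundary C)"
proof -
  let ?n = "card C" and ?p = "card (edge_boundary C)"
  have iso: "16 * ?n \<le> ?p\<^sup>2"
    by (rule isoperimetric) fact
  \<comment> \<open>Since \<open>C\<close> is nonempty, \<open>?p\<close> is positive, so
    multiplying the hypothesis by \<open>?p\<^sup>2\<close> keeps it strict. The claim is then
    proved by comparing squares.\<close>
  have "?n > 0"
    using assms(1,2) by (simp add: card_gt_0_iff)
  then have "?p\<^sup>2 > 0"
    using iso by linarith
  have "(4 * c * ?n)\<^sup>2 = 16 * ?n * (?n * c\<^sup>2)"
    by (simp add: power2_eq_square)
  also have "\<dots> \<le> ?p\<^sup>2 * (?n * c\<^sup>2)"
    using iso by (rule mult_le_mono1)
  also have "\<dots> < ?p\<^sup>2 * m\<^sup>2"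
    using \<open>?p\<^sup>2 > 0\<close> assms(3) by simp
  also have "\<dots> = (m * ?p)\<^sup>2"
    by (simp add: power_mult_distrib)
  finally show ?thesis
    by (rule power_less_imp_less_base) simp
qed

theorem theorem2:
  fixes m c :: nat and R :: "cell set" and F :: "cell \<Rightarrow> nat"
  assumes "m > 0" and "c > 0"
    and "c dvd m"
    and "m \<ge> c * (c + 1)"
    and "binary_image R F"
    and "card (ones R F) = m\<^sup>2"
    and "card (boundary R F) = 4 * m * c"
  shows "real (Max (card ` components R F)) \<ge> (real m)\<^sup>2 / (real c)\<^sup>2"
proof (rule ccontr)
  let ?K = "components R F"
  assume "\<not> ?thesis"
  then have "real (Max (card ` ?K)) * (real c)\<^sup>2 < (real m)\<^sup>2"
    using \<open>c > 0\<close> by (simp add: field_simps)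
  then have "real (Max (card ` ?K) * c\<^sup>2) < real (m\<^sup>2)"
    by simp
  then have max: "Max (card ` ?K) * c\<^sup>2 < m\<^sup>2"
    by (simp only: of_nat_less_iff)
  have finK: "finite ?K"
    using \<open>binary_image R F\<close> by (rule finite_components)
  \<comment> \<open>Infinite sets have cardinality 0, so a positive cardinality implies
    finiteness.\<close>
  have fin: "finite (ones R F)"
    using \<open>card (ones R F) = m\<^sup>2\<close> \<open>m > 0\<close> by (intro card_ge_0_finite) simp
  have total: "sum card ?K = m\<^sup>2"
    using sum_card_components[OF fin] \<open>card (ones R F) = m\<^sup>2\<close> by simp
  \<comment> \<open>An empty sum would be 0 instead of \<open>m\<^sup>2\<close>; with a component
    present, the termwise strict inequality stays strict after summation.\<close>
  then have "?K \<noteq> {}"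
    using \<open>m > 0\<close> by auto
  have small: "4 * c * card C < m * card (edge_boundary C)" if "C \<in> ?K" for C
  proof (rule small_set_edge_boundary)
    show "finite C"
      using component_subset_ones[OF that] fin by (rule finite_subset)
    show "C \<noteq> {}"
      using in_quotient_imp_non_empty[OF equiv_connected_ones] that
      unfolding components_def by blast
    have "card C \<le> Max (card ` ?K)"
      using finK that by simp
    then show "card C * c\<^sup>2 < m\<^sup>2"
      using max by (meson le_less_trans mult_le_mono1)
  qed
  have "4 * c * m\<^sup>2 = (\<Sum>C\<in>?K. 4 * c * card C)"
    using total by (simp flip: sum_distrib_left)
  also have "\<dots> < (\<Sum>C\<in>?K. m * card (edge_boundary C))"
    using finK \<open>?K \<noteq> {}\<close> small by (rule sum_strict_mono)
  also have "\<dots> = m * (\<Sum>C\<in>?K. card (edge_boundary C))"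
    by (simp add: sum_distrib_left)
  also have "\<dots> \<le> m * (4 * m * c)"
    using sum_card_edge_boundary_le[OF \<open>binary_image R F\<close>] \<open>card (boundary R F) = 4 * m * c\<close>
    by simp
  finally show False
    by (simp add: power2_eq_square)
qed

end
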